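(* If $f(z)=z+\sum_{n=2}^{\infty}a_nz^n\in \mathcal{S}_{S,e}^*$, then $$|H_{2,3}(f^{-1})-H_{2,3}(f)|\leq\frac{3}{8}.$$ The inequality is sharp for the function $f_1(z)=z+\frac12z^3+\frac14z^5+\cdots$ (that is, equality holds for $f=f_1$).
   Context: $\mathbb{D}=\{z\in\mathbb{C}:|z|<1\}$. $\mathcal{S}$ is the class of univalent (injective) analytic functions $f$ on $\mathbb{D}$ with expansion $f(z)=z+\sum_{n\ge 2}a_nz^n$. For analytic $g,h$ on $\mathbb{D}$, $g\prec h$ (subordination) means $g=h\circ w$ for some analytic $w:\mathbb{D}\to\mathbb{D}$ with $w(0)=0$. The class is $$\mathcal{S}_{S,e}^*=\left\{f\in\mathcal{S}:\ \frac{2zf'(z)}{f(z)-f(-z)}\prec e^z\right\}.$$ For $f\in\mathcal{S}$, the inverse function near $0$ is $f^{-1}(w)=w+A_2w^2+A_3w^3+A_4w^4+A_5w^5+\cdots$. Set $H_{2,3}(f):=a_3a_5-a_4^2$ and $H_{2,3}(f^{-1}):=A_3A_5-A_4^2$. The function $f_1\in\mathcal{S}_{S,e}^*$ is the one determined by $\frac{2zf_1'(z)}{f_1(z)-f_1(-z)}=e^{z^2}$, $f_1(0)=f_1'(0)-1=0$. *)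

theory Defs
  imports "HOL-Complex_Analysis.Complex_Analysis"
begin

abbreviation unit_disc :: "complex set" where
  "unit_disc \<equiv> ball 0 1"

text \<open>
  Functions on the disc are total functions of type \<open>complex \<Rightarrow> complex\<close>; only their
  values on \<open>unit_disc\<close> matter below.
\<close>

definition class_S :: "(complex \<Rightarrow> complex) set" where
  "class_S = {f. f holomorphic_on unit_disc \<and> inj_on f unit_disc \<and> f 0 = 0 \<and> deriv f 0 = 1}"

text \<open>
  Subordination, meant for \<open>g\<close> and \<open>h\<close> that are analytic on the disc.
\<close>

definition subordinate :: "(complex \<Rightarrow> complex) \<Rightarrow> (complex \<Rightarrow> complex) \<Rightarrow> bool"
    (infix "\<prec>\<^sub>s" 50) where
  "g \<prec>\<^sub>s h \<longleftrightarrow>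
     (\<exists>w. w holomorphic_on unit_disc \<and> w ` unit_disc \<subseteq> unit_disc \<and> w 0 = 0 \<and>
          (\<forall>z\<in>unit_disc. g z = h (w z)))"

text \<open>
  The quotient \<open>2 z f'(z) / (f(z) - f(-z))\<close> has a removable singularity at \<open>0\<close>, where the
  division in HOL would yield \<open>0\<close>. For \<open>f(0) = 0\<close>, \<open>f'(0) = 1\<close> its limit there is \<open>1\<close>.
\<close>

definition sym_quotient :: "(complex \<Rightarrow> complex) \<Rightarrow> complex \<Rightarrow> complex" where
  "sym_quotient f z = (if z = 0 then 1 else 2 * z * deriv f z / (f z - f (- z)))"

definition class_S_Se :: "(complex \<Rightarrow> complex) set" where
  "class_S_Se = {f \<in> class_S. sym_quotient f \<prec>\<^sub>s exp}"

abbreviation taylor_coeff :: "(complex \<Rightarrow> complex) \<Rightarrow> nat \<Rightarrow> complex" where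
  "taylor_coeff f n \<equiv> fps_nth (fps_expansion f 0) n"

definition hankel23 :: "(complex \<Rightarrow> complex) \<Rightarrow> complex" where
  "hankel23 f = taylor_coeff f 3 * taylor_coeff f 5 - (taylor_coeff f 4)\<^sup>2"

text \<open>
  For \<open>f\<close> in \<^const>\<open>class_S\<close> this is analytic on the open set \<open>f ` unit_disc\<close>, which
  contains \<open>0\<close>.
\<close>

abbreviation disc_inverse :: "(complex \<Rightarrow> complex) \<Rightarrow> complex \<Rightarrow> complex" where
  "disc_inverse f \<equiv> inv_into unit_disc f"

text \<open>
  The conditions that determine the extremal function on the disc. For \<open>z \<noteq> 0\<close> the equation
  forces \<open>f z \<noteq> f (- z)\<close>, since division by zero yields \<open>0\<close> and \<open>exp\<close> has no zeros.
\<close>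

definition is_extremal_f1 :: "(complex \<Rightarrow> complex) \<Rightarrow> bool" where
  "is_extremal_f1 f \<longleftrightarrow>
     f holomorphic_on unit_disc \<and> f 0 = 0 \<and> deriv f 0 = 1 \<and>
     (\<forall>z\<in>unit_disc. sym_quotient f z = exp (z\<^sup>2))"

end

theory Submission
  imports Defs
begin

text \<open>
  Write \<open>w(z) = c\<^sub>1 z + c\<^sub>2 z\<^sup>2 + \<dots>\<close> for the Schwarz function with
  \<open>2 z f'(z) = (f(z) - f(-z)) e\<^bsup>w(z)\<^esup>\<close>. Comparing coefficients expresses \<open>192\<close> times the
  difference of the Hankel determinants as minus
  \<open>c\<^sub>1\<^sup>6 + 16 c\<^sub>1\<^sup>4 c\<^sub>2 - 12 c\<^sub>1\<^sup>3 c\<^sub>3 + 36 c\<^sub>1\<^sup>2 c\<^sub>2\<^sup>2 + 24 c\<^sub>1\<^sup>2 c\<^sub>4 - 48 c\<^sub>1 c\<^sub>2 c\<^sub>3 + 72 c\<^sub>2\<^sup>3\<close>.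
  The triangle inequality loses nothing at the extremal point \<open>c\<^sub>2 = 1\<close>, and Bessel's inequality
  \<open>\<Sum>\<bar>c\<^sub>n\<bar>\<^sup>2 \<le> 1\<close> is the only information about \<open>w\<close> that is needed to bound the result by \<open>72\<close>.

  The extremal function is \<open>z exp (E(z\<^sup>2) / 2)\<close> with \<open>E(u) = \<Sum> u\<^sup>n / (n n!)\<close>, and its derivative is
  \<open>exp (E(z\<^sup>2) / 2 + z\<^sup>2)\<close>. Since the imaginary part of this exponent is less than \<open>\<pi> / 2\<close> in modulus on the
  disc, the derivative has positive real part, which gives univalence.
\<close>

subsection \<open>Coefficients of bounded functions\<close>

text \<open>The variables stand for the moduli of \<open>c\<^sub>1\<close>, ...,
  \<open>c\<^sub>4\<close>. Every term except \<open>72 * b ^ 3\<close> contains a product of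
  \<open>c\<close>, \<open>d\<close>, \<open>e\<close> that is at most a multiple of
  \<open>1 - b\<^sup>2\<close>, so the estimate reduces to a polynomial in \<open>b\<close> alone,
  with value 72 at \<open>b = 1\<close>.\<close>

lemma coefficient_majorant_le:
  fixes c b d e :: real
  assumes nonneg: "0 \<le> c" "0 \<le> b" "0 \<le> d" "0 \<le> e"
    and sphere: "c\<^sup>2 + b\<^sup>2 + d\<^sup>2 + e\<^sup>2 \<le> 1"
  shows "c ^ 6 + 16 * c ^ 4 * b + 12 * c ^ 3 * d + 36 * c\<^sup>2 * b\<^sup>2 + 24 * c\<^sup>2 * e
    + 48 * c * b * d + 72 * b ^ 3 \<le> 72"
proof -
  define t where "t = c\<^sup>2"
  define s where "s = 1 - b\<^sup>2"
  have t: "0 \<le> t" "t + d\<^sup>2 \<le> s" "t \<le> s" "s \<le> 1"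
    using sphere by (auto simp: t_def s_def intro: order_trans[rotated])
      (smt (verit) zero_le_power2)+
  have b1: "b \<le> 1"
    using t \<open>0 \<le> b\<close> by (smt (verit) power2_le_imp_le one_power2 s_def)
  have e1: "e \<le> 1"
    using sphere by (smt (verit) power2_le_imp_le one_power2 zero_le_power2)
  have cd: "2 * (c * d) \<le> s"
    using t sum_squares_bound[of c d] by (simp add: t_def)
  have t2: "t\<^sup>2 \<le> s" and t3: "t ^ 3 \<le> s"
    using t by (smt (verit) mult_left_le power2_eq_square power3_eq_cube mult_mono)+
  have "c ^ 6 \<le> s"
    using t3 by (simp add: t_def flip: power_mult)
  moreover have "16 * c ^ 4 * b \<le> 16 * s * b"
    using mult_right_mono[OF t2 \<open>0 \<le> b\<close>] by (simp add: t_def flip: power_mult)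
  moreover have "12 * c ^ 3 * d \<le> 6 * s"
  proof -
    have "t * (2 * (c * d)) \<le> 1 * s"
      using t cd nonneg by (intro mult_mono) auto
    then show ?thesis
      by (simp add: t_def power2_eq_square power3_eq_cube mult_ac)
  qed
  moreover have "36 * c\<^sup>2 * b\<^sup>2 \<le> 36 * s * b\<^sup>2"
    using t by (intro mult_right_mono) (auto simp: t_def)
  moreover have "24 * c\<^sup>2 * e \<le> 24 * s"
    using mult_mono[OF t(3) e1] t nonneg by (simp add: t_def)
  moreover have "48 * c * b * d \<le> 24 * b * s"
    using mult_left_mono[OF cd \<open>0 \<le> b\<close>] by (simp add: mult_ac)
  ultimately have "c ^ 6 + 16 * c ^ 4 * b + 12 * c ^ 3 * d + 36 * c\<^sup>2 * b\<^sup>2 + 24 * c\<^sup>2 * e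
      + 48 * c * b * d + 72 * b ^ 3
      \<le> s + 16 * s * b + 6 * s + 36 * s * b\<^sup>2 + 24 * s + 24 * b * s + 72 * b ^ 3"
    by linarith
  \<comment> \<open>The root \<open>b = 1\<close> is split off; the cofactor is nonnegative on the
    unit interval because \<open>4 * b\<^sup>2 + 36 * b ^ 3\<close> is at most 40 there.\<close>
  also have "\<dots> = 72 - (1 - b) * (41 + b - 4 * b\<^sup>2 - 36 * b ^ 3)"
    by (simp add: s_def algebra_simps power2_eq_square power3_eq_cube)
  also have "\<dots> \<le> 72"
  proof -
    have "b\<^sup>2 \<le> 1" "b ^ 3 \<le> 1"
      using b1 nonneg by (auto intro: power_le_one)
    then have "0 \<le> (1 - b) * (41 + b - 4 * b\<^sup>2 - 36 * b ^ 3)"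
      using b1 nonneg by (intro mult_nonneg_nonneg) auto
    then show ?thesis by simp
  qed
  finally show ?thesis .
qed

text \<open>Cauchy's formula for the n-th derivative on the circle of radius \<open>r\<close>,
  rescaled by \<open>r ^ n / i\<close>. On the unit circle the reciprocal of \<open>cis t\<close> is
  its conjugate, so this is a Fourier coefficient.\<close>

lemma has_integral_taylor_coeff:
  assumes holo: "g holomorphic_on ball 0 R" and r: "0 < r" "r < R"
  shows "((\<lambda>t. g (of_real r * cis t) * cnj (cis t) ^ n) has_integral
    2 * pi * of_real r ^ n * taylor_coeff g n) {0..2 * pi}"
proof -
  have "((\<lambda>u. g u / (u - 0) ^ Suc n) has_contour_integral
      (2 * pi * \<i>) / fact n * (deriv ^^ n) g 0) (circlepath 0 r)"
    using r by (intro Cauchy_has_contour_integral_higher_derivative_circlepath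
      holomorphic_on_imp_continuous_on holomorphic_on_subset[OF holo]) auto
  then have "((\<lambda>t. g (0 + of_real r * cis t) / (0 + of_real r * cis t - 0) ^ Suc n * of_real r * \<i> * cis t)
      has_integral (2 * pi * \<i>) / fact n * (deriv ^^ n) g 0) {0..2 * pi}"
    unfolding circlepath_def by (subst (asm) has_contour_integral_part_circlepath_iff) auto
  from has_integral_mult_left[OF this, of "of_real r ^ n / \<i>"]
  have "((\<lambda>t. g (0 + of_real r * cis t) / (0 + of_real r * cis t - 0) ^ Suc n * of_real r * \<i> * cis t
        * (of_real r ^ n / \<i>))
      has_integral (2 * pi * \<i>) / fact n * (deriv ^^ n) g 0 * (of_real r ^ n / \<i>)) {0..2 * pi}" .
  also have "(2 * pi * \<i>) / fact n * (deriv ^^ n) g 0 * (of_real r ^ n / \<i>)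
      = 2 * pi * of_real r ^ n * taylor_coeff g n"
    by (simp add: fps_expansion_def field_simps)
  also have "(\<lambda>t. g (0 + of_real r * cis t) / (0 + of_real r * cis t - 0) ^ Suc n * of_real r * \<i> * cis t
        * (of_real r ^ n / \<i>)) = (\<lambda>t. g (of_real r * cis t) * cnj (cis t) ^ n)"
    using r by (intro ext) (simp add: field_simps power_mult_distrib cis_cnj flip: cis_inverse)
  finally show ?thesis .
qed

text \<open>Integrates \<open>0 \<le> \<bar>w - p\<bar>\<^sup>2\<close> over the circle of radius \<open>r\<close>, with \<open>p\<close> the Taylor polynomial of \<open>w\<close>.\<close>
lemma sum_taylor_coeff_squares_le_radius:
  assumes holo: "w holomorphic_on unit_disc" and bound: "w ` unit_disc \<subseteq> unit_disc"
    and r: "0 < r" "r < 1"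
  shows "(\<Sum>n<N. (cmod (taylor_coeff w n))\<^sup>2 * (r ^ n)\<^sup>2) \<le> 1"
proof -
  define c where "c = taylor_coeff w"
  define p where "p = (\<lambda>z. \<Sum>n<N. c n * z ^ n)"
  define M where "M = (\<Sum>n<N. (cmod (c n))\<^sup>2 * (r ^ n)\<^sup>2)"
  let ?z = "\<lambda>t. of_real r * cis t"
  \<comment> \<open>Pairing with the conjugate of \<open>p\<close> sees only the first
    \<open>N\<close> coefficients of \<open>g\<close>. Hence \<open>w\<close> and \<open>p\<close>
    itself give the same value.\<close>
  have int: "((\<lambda>t. g (?z t) * cnj (p (?z t))) has_integral 2 * pi * of_real M) {0..2 * pi}"
    if "g holomorphic_on ball 0 1" and g: "\<And>n. n < N \<Longrightarrow> taylor_coeff g n = c n" for g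
  proof -
    have "((\<lambda>t. \<Sum>n<N. cnj (c n) * of_real r ^ n * (g (?z t) * cnj (cis t) ^ n)) has_integral
        (\<Sum>n<N. cnj (c n) * of_real r ^ n * (2 * pi * of_real r ^ n * taylor_coeff g n))) {0..2 * pi}"
      using that r by (intro has_integral_sum has_integral_mult_right has_integral_taylor_coeff) auto
    also have "(\<Sum>n<N. cnj (c n) * of_real r ^ n * (2 * pi * of_real r ^ n * taylor_coeff g n))
        = (\<Sum>n<N. complex_of_real (2 * pi * ((cmod (c n))\<^sup>2 * (r ^ n)\<^sup>2)))"
    proof (rule sum.cong[OF refl])
      fix n assume "n \<in> {..<N}"
      then show "cnj (c n) * of_real r ^ n * (2 * pi * of_real r ^ n * taylor_coeff g n)
          = complex_of_real (2 * pi * ((cmod (c n))\<^sup>2 * (r ^ n)\<^sup>2))"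
        using g[of n] complex_norm_square[of "c n"] by (simp add: power2_eq_square)
    qed
    also have "\<dots> = 2 * pi * of_real M"
      by (simp add: M_def sum_distrib_left)
    also have "(\<lambda>t. \<Sum>n<N. cnj (c n) * of_real r ^ n * (g (?z t) * cnj (cis t) ^ n))
        = (\<lambda>t. g (?z t) * cnj (p (?z t)))"
      by (simp add: p_def sum_distrib_left power_mult_distrib mult_ac)
    finally show ?thesis .
  qed
  have "p has_fps_expansion (\<Sum>n<N. fps_const (c n) * fps_X ^ n)"
    unfolding p_def by (intro fps_expansion_intros)
  then have p: "taylor_coeff p n = c n" if "n < N" for n
    using that by (simp add: fps_expansion_eqI fps_sum_nth if_distrib cong: if_cong)
  have "p holomorphic_on ball 0 1"
    unfolding p_def by (intro holomorphic_intros)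
  note ip = int[OF this p]
  have iw: "((\<lambda>t. w (?z t) * cnj (p (?z t))) has_integral 2 * pi * of_real M) {0..2 * pi}"
    using holo by (intro int) (auto simp: c_def)
  \<comment> \<open>The integrand is the expansion of the squared modulus of \<open>w - p\<close>
    with the squared modulus of \<open>w\<close> replaced by its upper bound 1. Its integral is
    \<open>2 * pi * (1 - M)\<close>.\<close>
  have "((\<lambda>t. 1 - 2 * Re (w (?z t) * cnj (p (?z t))) + Re (p (?z t) * cnj (p (?z t)))) has_integral
      (2 * pi * 1 - 2 * Re (2 * pi * of_real M) + Re (2 * pi * of_real M))) {0..2 * pi}"
    using has_integral_const_real[of "1::real" 0 "2 * pi"]
    by (intro has_integral_add has_integral_diff has_integral_mult_right
      has_integral_Re ip iw) auto
  moreover have "0 \<le> 1 - 2 * Re (w (?z t) * cnj (p (?z t))) + Re (p (?z t) * cnj (p (?z t)))" for t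
  proof -
    have "?z t \<in> unit_disc" using r by (simp add: norm_mult)
    then have "cmod (w (?z t)) < 1" using bound by (auto simp: image_subset_iff)
    then have "(cmod (w (?z t)))\<^sup>2 \<le> 1" by (simp add: abs_square_le_1)
    moreover have "(cmod (w (?z t) - p (?z t)))\<^sup>2 = (cmod (w (?z t)))\<^sup>2
        - 2 * Re (w (?z t) * cnj (p (?z t))) + Re (p (?z t) * cnj (p (?z t)))"
      by (simp only: cmod_power2) (simp add: power2_eq_square algebra_simps)
    ultimately show ?thesis
      using zero_le_power2[of "cmod (w (?z t) - p (?z t))"] by linarith
  qed
  ultimately have "0 \<le> 2 * pi * 1 - 2 * Re (2 * pi * of_real M) + Re (2 * pi * of_real M)"
    by (rule has_integral_nonneg)
  then have "0 \<le> 2 * pi * (1 - M)"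
    by (simp add: algebra_simps)
  then have "M \<le> 1"
    using pi_gt_zero by (simp add: zero_le_mult_iff)
  then show ?thesis by (simp add: M_def c_def)
qed

text \<open>The sum is finite, so the radius can tend to 1 from the left.\<close>

lemma sum_taylor_coeff_squares_le:
  assumes "w holomorphic_on unit_disc" and "w ` unit_disc \<subseteq> unit_disc"
  shows "(\<Sum>n<N. (cmod (taylor_coeff w n))\<^sup>2) \<le> 1"
proof (rule tendsto_upperbound)
  have "((\<lambda>r::real. \<Sum>n<N. (cmod (taylor_coeff w n))\<^sup>2 * (r ^ n)\<^sup>2) \<longlongrightarrow>
      (\<Sum>n<N. (cmod (taylor_coeff w n))\<^sup>2 * (1 ^ n)\<^sup>2)) (at_left 1)"
    by (intro tendsto_intros)
  then show "((\<lambda>r::real. \<Sum>n<N. (cmod (taylor_coeff w n))\<^sup>2 * (r ^ n)\<^sup>2) \<longlongrightarrow>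
      (\<Sum>n<N. (cmod (taylor_coeff w n))\<^sup>2)) (at_left 1)"
    by simp
  have "eventually (\<lambda>r::real. r \<in> {0<..<1}) (at_left 1)"
    by (rule eventually_at_leftI[of 0]) auto
  then show "eventually (\<lambda>r::real. (\<Sum>n<N. (cmod (taylor_coeff w n))\<^sup>2 * (r ^ n)\<^sup>2) \<le> 1) (at_left 1)"
    by eventually_elim (use assms in \<open>auto intro: sum_taylor_coeff_squares_le_radius\<close>)
qed auto

subsection \<open>Coefficients of the inverse and of solutions of the functional equation\<close>

text \<open>Since \<open>F ^ i\<close> starts with the i-th power of the variable, comparing
  coefficients in \<open>G oo F = fps_X\<close> gives a triangular linear system for the
  coefficients of \<open>G\<close>, solved from the top down.\<close>

lemma fps_compose_inverse_coeffs:
  fixes F G :: "complex fps"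
  assumes F: "fps_nth F 0 = 0" "fps_nth F 1 = 1" and GF: "G oo F = fps_X"
  defines "a \<equiv> fps_nth F" and "A \<equiv> fps_nth G"
  shows "A 3 = 2 * (a 2)\<^sup>2 - a 3"
    and "A 4 = 5 * a 2 * a 3 - 5 * (a 2) ^ 3 - a 4"
    and "A 5 = 14 * (a 2) ^ 4 - 21 * (a 2)\<^sup>2 * a 3 + 6 * a 2 * a 4 + 3 * (a 3)\<^sup>2 - a 5"
proof -
  note expand = fps_mult_nth eval_nat_numeral sum.atLeast0_atMost_Suc
  have F1: "fps_nth F (Suc 0) = 1" using F by simp
  have p2: "fps_nth (F\<^sup>2) 0 = 0" "fps_nth (F\<^sup>2) 1 = 0" "fps_nth (F\<^sup>2) 2 = 1"
    "fps_nth (F\<^sup>2) 3 = 2 * a 2" "fps_nth (F\<^sup>2) 4 = 2 * a 3 + (a 2)\<^sup>2"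
    "fps_nth (F\<^sup>2) 5 = 2 * a 4 + 2 * a 2 * a 3"
    by (simp_all add: a_def F F1 power2_eq_square expand)
  have p3: "fps_nth (F ^ 3) 0 = 0" "fps_nth (F ^ 3) 1 = 0" "fps_nth (F ^ 3) 2 = 0"
    "fps_nth (F ^ 3) 3 = 1" "fps_nth (F ^ 3) 4 = 3 * a 2" "fps_nth (F ^ 3) 5 = 3 * a 3 + 3 * (a 2)\<^sup>2"
    using p2 by (simp_all add: a_def F F1 power3_eq_cube power2_eq_square expand)
  have eq4: "F ^ 4 = F\<^sup>2 * F\<^sup>2" and eq5: "F ^ 5 = F ^ 3 * F\<^sup>2"
    by (simp_all flip: power_add)
  have p4: "fps_nth (F ^ 4) 0 = 0" "fps_nth (F ^ 4) 1 = 0" "fps_nth (F ^ 4) 2 = 0"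
    "fps_nth (F ^ 4) 3 = 0" "fps_nth (F ^ 4) 4 = 1" "fps_nth (F ^ 4) 5 = 4 * a 2"
    unfolding eq4 using p2 by (simp_all add: expand)
  have p5: "fps_nth (F ^ 5) 0 = 0" "fps_nth (F ^ 5) 1 = 0" "fps_nth (F ^ 5) 2 = 0"
    "fps_nth (F ^ 5) 3 = 0" "fps_nth (F ^ 5) 4 = 0" "fps_nth (F ^ 5) 5 = 1"
    unfolding eq5 using p2 p3 by (simp_all add: expand)
  have *: "(\<Sum>i\<le>n. A i * fps_nth (F ^ i) n) = (if n = 1 then 1 else 0)" for n
    using arg_cong[OF GF, of "\<lambda>H. fps_nth H n"]
    by (simp add: fps_compose_nth A_def atLeast0AtMost)
  have c: "A 1 = 1" "A 2 + A 1 * a 2 = 0"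
    "A 3 + A 2 * (2 * a 2) + A 1 * a 3 = 0"
    "A 4 + A 3 * (3 * a 2) + A 2 * (2 * a 3 + (a 2)\<^sup>2) + A 1 * a 4 = 0"
    "A 5 + A 4 * (4 * a 2) + A 3 * (3 * a 3 + 3 * (a 2)\<^sup>2) + A 2 * (2 * a 4 + 2 * a 2 * a 3) + A 1 * a 5 = 0"
    using *[of 1] *[of 2] *[of 3] *[of 4] *[of 5] p2 p3 p4 p5 F1
    by (simp_all add: a_def eval_nat_numeral algebra_simps)
  have A2: "A 2 = - a 2"
    using c by (simp add: eq_neg_iff_add_eq_0)
  show A3: "A 3 = 2 * (a 2)\<^sup>2 - a 3"
    using c(3) unfolding c(1) A2 by algebra
  show A4: "A 4 = 5 * a 2 * a 3 - 5 * (a 2) ^ 3 - a 4"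
    using c(4) unfolding c(1) A2 A3 by algebra
  show "A 5 = 14 * (a 2) ^ 4 - 21 * (a 2)\<^sup>2 * a 3 + 6 * a 2 * a 4 + 3 * (a 3)\<^sup>2 - a 5"
    using c(5) unfolding c(1) A2 A3 A4 by algebra
qed

lemma disc_inverse_fps_expansion:
  assumes "f \<in> class_S"
  shows "fps_expansion (disc_inverse f) 0 oo fps_expansion f 0 = fps_X"
proof -
  have holo: "f holomorphic_on unit_disc" and inj: "inj_on f unit_disc" and f0: "f 0 = 0"
    using assms by (auto simp: class_S_def)
  obtain g where g: "g holomorphic_on f ` unit_disc" "\<And>z. z \<in> unit_disc \<Longrightarrow> g (f z) = z"
    using holomorphic_has_inverse[OF holo open_ball inj] by metis
  \<comment> \<open>The choice-based inverse agrees on the image with the holomorphic inverse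
    \<open>g\<close>, so its formal expansion at 0 really represents it.\<close>
  have "disc_inverse f holomorphic_on f ` unit_disc"
    using g inj by (intro holomorphic_transform[OF g(1)]) auto
  moreover have "open (f ` unit_disc)"
    using holo inj by (intro open_mapping_thm3) auto
  moreover have "0 \<in> f ` unit_disc"
    using f0 by force
  ultimately have G: "disc_inverse f has_fps_expansion fps_expansion (disc_inverse f) 0"
    by (intro has_fps_expansion_fps_expansion)
  have F: "f has_fps_expansion fps_expansion f 0"
    using holo by (intro has_fps_expansion_fps_expansion[of unit_disc]) auto
  have "(disc_inverse f \<circ> f) has_fps_expansion (fps_expansion (disc_inverse f) 0 oo fps_expansion f 0)"
    using G F by (rule has_fps_expansion_compose) (simp add: fps_expansion_def f0)
  moreover have "eventually (\<lambda>z. z \<in> unit_disc) (nhds 0)"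
    by (intro eventually_nhds_in_open) auto
  then have "eventually (\<lambda>z. (disc_inverse f \<circ> f) z = z) (nhds 0)"
    by eventually_elim (use inj in \<open>simp add: inv_into_f_f\<close>)
  ultimately have "(\<lambda>z. z) has_fps_expansion (fps_expansion (disc_inverse f) 0 oo fps_expansion f 0)"
    by (subst (asm) has_fps_expansion_cong) auto
  then show ?thesis
    using fps_expansion_unique_complex has_fps_expansion_fps_X by blast
qed

text \<open>The terms \<open>a 3 * a 5\<close> and \<open>(a 4)\<^sup>2\<close> of the two
  determinants cancel. What remains is isobaric of weight 6 when \<open>a n\<close> has weight
  \<open>n - 1\<close>, and only the last term is free of \<open>a 2\<close>.\<close>

lemma hankel23_inverse_diff:
  assumes "f \<in> class_S"
  defines "a \<equiv> taylor_coeff f"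
  shows "hankel23 (disc_inverse f) - hankel23 f =
    3 * (a 2) ^ 6 - 6 * (a 2) ^ 4 * a 3 + 2 * (a 2) ^ 3 * a 4 + 2 * (a 2)\<^sup>2 * (a 3)\<^sup>2
    - 2 * (a 2)\<^sup>2 * a 5 + 4 * a 2 * a 3 * a 4 - 3 * (a 3) ^ 3"
proof -
  have "fps_nth (fps_expansion f 0) 0 = 0" "fps_nth (fps_expansion f 0) 1 = 1"
    using assms by (auto simp: fps_expansion_def class_S_def)
  from fps_compose_inverse_coeffs[OF this disc_inverse_fps_expansion[OF assms(1)]]
  show ?thesis
    unfolding hankel23_def a_def by algebra
qed

section \<open>The functional equation as a recursion for coefficients\<close>

lemma fps_expansion_sym_quotient:
  assumes f: "f holomorphic_on unit_disc" and f0: "f 0 = 0"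
    and w: "w holomorphic_on unit_disc"
    and eq: "\<forall>z\<in>unit_disc. sym_quotient f z = exp (w z)"
  defines "F \<equiv> fps_expansion f 0"
  shows "2 * (fps_X * fps_deriv F) = (F - (F oo - fps_X)) * fps_expansion (\<lambda>z. exp (w z)) 0"
proof -
  have F: "f has_fps_expansion F"
    unfolding F_def using f by (intro has_fps_expansion_fps_expansion[of unit_disc]) auto
  have E: "(\<lambda>z. exp (w z)) has_fps_expansion fps_expansion (\<lambda>z. exp (w z)) 0"
    using w by (intro has_fps_expansion_fps_expansion[of unit_disc] holomorphic_intros) auto
  have "(f \<circ> uminus) has_fps_expansion (F oo - fps_X)"
    by (intro has_fps_expansion_compose F has_fps_expansion_minus has_fps_expansion_fps_X) auto
  then have F': "(\<lambda>z. f (- z)) has_fps_expansion (F oo - fps_X)"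
    by (simp add: o_def)
  have lhs: "(\<lambda>z. 2 * (z * deriv f z)) has_fps_expansion 2 * (fps_X * fps_deriv F)"
    by (intro fps_expansion_intros F)
  have rhs: "(\<lambda>z. (f z - f (- z)) * exp (w z)) has_fps_expansion
      (F - (F oo - fps_X)) * fps_expansion (\<lambda>z. exp (w z)) 0"
    by (intro fps_expansion_intros F F' E)
  have "eventually (\<lambda>z. z \<in> unit_disc) (nhds 0)"
    by (intro eventually_nhds_in_open) auto
  then have ev: "eventually (\<lambda>z. 2 * (z * deriv f z) = (f z - f (- z)) * exp (w z)) (nhds 0)"
  proof eventually_elim
    case (elim z)
    show ?case
    proof (cases "z = 0")
      case False
      have "2 * z * deriv f z / (f z - f (- z)) = exp (w z)"
        using bspec[OF eq elim] False by (simp add: sym_quotient_def)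
      \<comment> \<open>A zero denominator would make the quotient 0 by convention, but the
        exponential has no zeros.\<close>
      moreover from this have "f z - f (- z) \<noteq> 0"
        by (metis div_by_0 exp_not_eq_zero)
      ultimately show ?thesis by (simp add: field_simps)
    qed (simp add: f0)
  qed
  show ?thesis
    using lhs rhs unfolding has_fps_expansion_cong[OF ev refl] by (rule fps_expansion_unique_complex)
qed

text \<open>The factor \<open>1 - (-1) ^ k\<close> comes from \<open>f z - f (- z)\<close>: it is 2
  for odd \<open>k\<close> and removes the even coefficients.\<close>

lemma sym_quotient_coeff_recursion:
  assumes "f holomorphic_on unit_disc" "f 0 = 0" "w holomorphic_on unit_disc"
    and "\<forall>z\<in>unit_disc. sym_quotient f z = exp (w z)"
  shows "2 * of_nat n * taylor_coeff f n =
    (\<Sum>k\<le>n. (1 - (-1) ^ k) * taylor_coeff f k * taylor_coeff (\<lambda>z. exp (w z)) (n - k))"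
proof -
  let ?F = "fps_expansion f 0"
  have "?F - (?F oo - fps_X) = Abs_fps (\<lambda>k. (1 - (-1) ^ k) * fps_nth ?F k)"
    by (simp add: fps_eq_iff fps_compose_uminus' left_diff_distrib)
  then have eq: "2 * (fps_X * fps_deriv ?F)
      = Abs_fps (\<lambda>k. (1 - (-1) ^ k) * fps_nth ?F k) * fps_expansion (\<lambda>z. exp (w z)) 0"
    using fps_expansion_sym_quotient[OF assms] by (simp only:)
  have "2 * of_nat n * taylor_coeff f n = fps_nth (2 * (fps_X * fps_deriv ?F)) n"
    by (simp add: fps_mult_fps_X_deriv_shift)
  then show ?thesis
    by (simp only: eq fps_mult_nth[of "Abs_fps _"] fps_nth_Abs_fps atLeast0AtMost)
qed

text \<open>Moving the term \<open>k = n\<close> of the recursion to the left leaves the factor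
  \<open>2 * n - (1 - (-1) ^ n)\<close>, which is nonzero for \<open>n\<close> at least 2. The
  recursion thus determines all coefficients from the normalization.\<close>

lemma sym_quotient_unique:
  assumes f: "f holomorphic_on unit_disc" "f 0 = 0" "deriv f 0 = 1"
    and g: "g holomorphic_on unit_disc" "g 0 = 0" "deriv g 0 = 1"
    and w: "w holomorphic_on unit_disc" "w 0 = 0"
    and eqf: "\<forall>z\<in>unit_disc. sym_quotient f z = exp (w z)"
    and eqg: "\<forall>z\<in>unit_disc. sym_quotient g z = exp (w z)"
    and z: "z \<in> unit_disc"
  shows "g z = f z"
proof -
  define e where "e = taylor_coeff (\<lambda>z. exp (w z))"
  have e0: "e 0 = 1"
    by (simp add: e_def fps_expansion_def w)
  have "taylor_coeff g n = taylor_coeff f n" for n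
  proof (induction n rule: less_induct)
    case (less n)
    consider "n = 0" | "n = 1" | "2 \<le> n" by linarith
    then show ?case
    proof cases
      case 3
      have split: "(\<Sum>k\<le>n. h k) = (\<Sum>k<n. h k) + h n" for h :: "nat \<Rightarrow> complex"
        by (simp flip: lessThan_Suc_atMost)
      have rec: "(2 * of_nat n - (1 - (-1) ^ n)) * taylor_coeff h n =
          (\<Sum>k<n. (1 - (-1) ^ k) * taylor_coeff h k * e (n - k))"
        if "h holomorphic_on unit_disc" "h 0 = 0"
          "\<forall>z\<in>unit_disc. sym_quotient h z = exp (w z)" for h
        using sym_quotient_coeff_recursion[OF that(1,2) w(1) that(3), of n]
        by (simp add: split e0 algebra_simps flip: e_def)
      have "(2 * of_nat n - (1 - (-1) ^ n)) * taylor_coeff g n =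
          (2 * of_nat n - (1 - (-1) ^ n)) * taylor_coeff f n"
        using rec[OF f(1,2) eqf] rec[OF g(1,2) eqg] less.IH by simp
      moreover have "2 * of_nat n - (1 - (-1) ^ n) \<noteq> (0 :: complex)"
      proof
        assume "2 * of_nat n - (1 - (-1) ^ n) = (0 :: complex)"
        then have "of_nat (2 * n) = (1 - (-1) ^ n :: complex)" by simp
        also have "\<dots> = of_nat (if even n then 0 else 2)" by simp
        finally show False using 3 by (simp only: of_nat_eq_iff split: if_splits)
      qed
      ultimately show ?thesis by simp
    qed (simp_all add: fps_expansion_def f g)
  qed
  then have "fps_expansion g 0 = fps_expansion f 0"
    by (simp add: fps_eq_iff)
  \<comment> \<open>The Taylor series represents the function on the whole disc, so equal expansions
    give equality at \<open>z\<close> and not just near 0.\<close>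
  moreover have "eval_fps (fps_expansion h 0) z = h z" if "h holomorphic_on unit_disc" for h
    using that z by (intro has_fps_expansion_imp_eval_fps_eq[of h _ z 1]
      has_fps_expansion_fps_expansion[of unit_disc]) auto
  ultimately show ?thesis
    using f g by metis
qed

text \<open>Obtained by comparing coefficients in the differential equation
  \<open>E' = W' * E\<close> satisfied by \<open>E = exp w\<close>.\<close>

lemma exp_taylor_coeffs:
  assumes w: "w holomorphic_on unit_disc" and w0: "w 0 = 0"
  defines "c \<equiv> taylor_coeff w" and "e \<equiv> taylor_coeff (\<lambda>z. exp (w z))"
  shows "e 0 = 1" "e 1 = c 1" "2 * e 2 = 2 * c 2 + c 1 * e 1"
    "3 * e 3 = 3 * c 3 + 2 * c 2 * e 1 + c 1 * e 2"
    "4 * e 4 = 4 * c 4 + 3 * c 3 * e 1 + 2 * c 2 * e 2 + c 1 * e 3"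
proof -
  define W where "W = fps_expansion w 0"
  define E where "E = fps_expansion (\<lambda>z. exp (w z)) 0"
  have W: "w has_fps_expansion W"
    unfolding W_def using w by (intro has_fps_expansion_fps_expansion[of unit_disc]) auto
  have E: "(\<lambda>z. exp (w z)) has_fps_expansion E"
    unfolding E_def using w by (intro has_fps_expansion_fps_expansion[of unit_disc] holomorphic_intros) auto
  have rhs: "(\<lambda>z. deriv w z * exp (w z)) has_fps_expansion fps_deriv W * E"
    by (intro fps_expansion_intros W E)
  have lhs: "deriv (\<lambda>z. exp (w z)) has_fps_expansion fps_deriv E"
    by (intro fps_expansion_intros E)
  have "eventually (\<lambda>z. z \<in> unit_disc) (nhds 0)"
    by (intro eventually_nhds_in_open) auto
  then have ev: "eventually (\<lambda>z. deriv (\<lambda>z. exp (w z)) z = deriv w z * exp (w z)) (nhds 0)"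
  proof eventually_elim
    case (elim z)
    then have "(w has_field_derivative deriv w z) (at z)"
      using w by (intro holomorphic_derivI) auto
    then show ?case
      by (intro DERIV_imp_deriv) (auto intro!: derivative_eq_intros)
  qed
  have "fps_deriv E = fps_deriv W * E"
    using lhs rhs unfolding has_fps_expansion_cong[OF ev refl] by (rule fps_expansion_unique_complex)
  then have "fps_nth (fps_deriv E) n = fps_nth (fps_deriv W * E) n" for n
    by simp
  then have rec: "of_nat (Suc n) * e (Suc n) = (\<Sum>k\<le>n. of_nat (Suc k) * c (Suc k) * e (n - k))" for n
    by (simp only: fps_mult_nth fps_deriv_nth c_def e_def W_def E_def atLeast0AtMost Suc_eq_plus1)
  show e0: "e 0 = 1"
    by (simp add: e_def fps_expansion_def w0)
  show "e 1 = c 1"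
    using rec[of 0] e0 by simp
  show "2 * e 2 = 2 * c 2 + c 1 * e 1"
    using rec[of 1] e0 by (simp add: numeral_2_eq_2)
  show "3 * e 3 = 3 * c 3 + 2 * c 2 * e 1 + c 1 * e 2"
    using rec[of 2] e0 by (simp add: eval_nat_numeral)
  show "4 * e 4 = 4 * c 4 + 3 * c 3 * e 1 + 2 * c 2 * e 2 + c 1 * e 3"
    using rec[of 3] e0 by (simp add: eval_nat_numeral)
qed

lemma sym_quotient_coeffs:
  assumes f: "f holomorphic_on unit_disc" "f 0 = 0" "deriv f 0 = 1"
    and w: "w holomorphic_on unit_disc" "w 0 = 0"
    and eq: "\<forall>z\<in>unit_disc. sym_quotient f z = exp (w z)"
  defines "a \<equiv> taylor_coeff f" and "c \<equiv> taylor_coeff w"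
  shows "a 2 = c 1 / 2" "a 3 = c 2 / 2 + (c 1)\<^sup>2 / 4"
    "a 4 = c 3 / 4 + 3 * c 1 * c 2 / 8 + 5 * (c 1) ^ 3 / 48"
    "a 5 = c 4 / 4 + c 1 * c 3 / 4 + (c 2)\<^sup>2 / 4 + (c 1)\<^sup>2 * c 2 / 4 + (c 1) ^ 4 / 24"
proof -
  define e where "e = taylor_coeff (\<lambda>z. exp (w z))"
  note e = exp_taylor_coeffs[OF w, folded e_def c_def]
  have a1: "a (Suc 0) = 1"
    by (simp add: a_def fps_expansion_def f)
  note rec = sym_quotient_coeff_recursion[OF f(1,2) w(1) eq, folded e_def a_def]
  \<comment> \<open>For odd \<open>n\<close> the coefficient \<open>a n\<close> also occurs on the
    right of the recursion, with factor 2; collecting it turns 6 into 4 (then halved) and 10 into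
    8.\<close>
  have a: "2 * a 2 = e 1" "2 * a 3 = e 2" "8 * a 4 = 2 * e 3 + 2 * (e 1 * a 3)"
    "8 * a 5 = 2 * e 4 + 2 * (e 2 * a 3)"
    using rec[of 2] rec[of 3] rec[of 4] rec[of 5]
    by (simp_all add: eval_nat_numeral a1 e(1)[simplified] algebra_simps)
  show a2: "a 2 = c 1 / 2"
    using a e by (simp add: field_simps)
  have e2: "e 2 = c 2 + (c 1)\<^sup>2 / 2"
    using e by (simp add: field_simps power2_eq_square)
  show a3: "a 3 = c 2 / 2 + (c 1)\<^sup>2 / 4"
    using a(2) unfolding e2 by (simp add: field_simps)
  have e3: "e 3 = c 3 + c 1 * c 2 + (c 1) ^ 3 / 6"
    using e(4) unfolding e2 e(2) by (simp add: field_simps power2_eq_square power3_eq_cube)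
  show "a 4 = c 3 / 4 + 3 * c 1 * c 2 / 8 + 5 * (c 1) ^ 3 / 48"
    using a(3) unfolding e3 a3 e(2) by algebra
  have "24 * e 4 = 24 * c 4 + 24 * c 1 * c 3 + 12 * (c 2)\<^sup>2 + 12 * (c 1)\<^sup>2 * c 2 + (c 1) ^ 4"
    using e(5) unfolding e3 e2 e(2) by algebra
  moreover have "8 * (e 2 * a 3) = 4 * (c 2)\<^sup>2 + 4 * (c 1)\<^sup>2 * c 2 + (c 1) ^ 4"
    unfolding e2 a3 by (simp add: field_simps power2_eq_square power4_eq_xxxx)
  ultimately have "24 * a 5 = 6 * c 4 + 6 * c 1 * c 3 + 6 * (c 2)\<^sup>2 + 6 * (c 1)\<^sup>2 * c 2 + (c 1) ^ 4"
    using a(4) by algebra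
  then show "a 5 = c 4 / 4 + c 1 * c 3 / 4 + (c 2)\<^sup>2 / 4 + (c 1)\<^sup>2 * c 2 / 4 + (c 1) ^ 4 / 24"
    by (simp add: field_simps)
qed

section \<open>The bound for the whole class\<close>

lemma hankel23_inverse_diff_bound:
  assumes "f \<in> class_S_Se"
  shows "norm (hankel23 (disc_inverse f) - hankel23 f) \<le> 3 / 8"
proof -
  have S: "f \<in> class_S" and f: "f holomorphic_on unit_disc" "f 0 = 0" "deriv f 0 = 1"
    using assms by (auto simp: class_S_Se_def class_S_def)
  obtain w where w: "w holomorphic_on unit_disc" "w ` unit_disc \<subseteq> unit_disc" "w 0 = 0"
    and eq: "\<forall>z\<in>unit_disc. sym_quotient f z = exp (w z)"
    using assms by (auto simp: class_S_Se_def subordinate_def)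
  define c where "c = taylor_coeff w"
  note a = sym_quotient_coeffs[OF f w(1,3) eq, folded c_def]
  have "hankel23 (disc_inverse f) - hankel23 f =
      - (c 1 ^ 6 + 16 * c 1 ^ 4 * c 2 - 12 * c 1 ^ 3 * c 3 + 36 * (c 1)\<^sup>2 * (c 2)\<^sup>2
        + 24 * (c 1)\<^sup>2 * c 4 - 48 * c 1 * c 2 * c 3 + 72 * c 2 ^ 3) / 192"
  proof -
    \<comment> \<open>this scaling makes all coefficients integral\<close>
    define p q r s where "p = c 1 / 12" and "q = c 2 / 2" and "r = c 3 / 4" and "s = c 4 / 4"
    have c: "c 1 = 12 * p" "c 2 = 2 * q" "c 3 = 4 * r" "c 4 = 4 * s"
      by (simp_all add: p_def q_def r_def s_def)
    have a': "taylor_coeff f 2 = 6 * p" "taylor_coeff f 3 = q + 36 * p\<^sup>2"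
      "taylor_coeff f 4 = r + 9 * p * q + 180 * p ^ 3"
      "taylor_coeff f 5 = s + 12 * p * r + q\<^sup>2 + 72 * p\<^sup>2 * q + 864 * p ^ 4"
      unfolding a c by (simp_all add: power_mult_distrib)
    show ?thesis
      unfolding hankel23_inverse_diff[OF S] a' c eq_divide_eq_numeral1 by (simp; algebra)
  qed
  moreover have "cmod (c 1 ^ 6 + 16 * c 1 ^ 4 * c 2 - 12 * c 1 ^ 3 * c 3 + 36 * (c 1)\<^sup>2 * (c 2)\<^sup>2
        + 24 * (c 1)\<^sup>2 * c 4 - 48 * c 1 * c 2 * c 3 + 72 * c 2 ^ 3) \<le>
      cmod (c 1) ^ 6 + 16 * cmod (c 1) ^ 4 * cmod (c 2) + 12 * cmod (c 1) ^ 3 * cmod (c 3)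
        + 36 * (cmod (c 1))\<^sup>2 * (cmod (c 2))\<^sup>2 + 24 * (cmod (c 1))\<^sup>2 * cmod (c 4)
        + 48 * cmod (c 1) * cmod (c 2) * cmod (c 3) + 72 * cmod (c 2) ^ 3"
  proof -
    have "norm (t1 + t2 - t3 + t4 + t5 - t6 + t7)
        \<le> norm t1 + norm t2 + norm t3 + norm t4 + norm t5 + norm t6 + norm t7"
      for t1 t2 t3 t4 t5 t6 t7 :: complex
      by (intro order_refl add_mono order_trans[OF norm_triangle_ineq] order_trans[OF norm_triangle_ineq4])
    then show ?thesis
      by (rule order_trans) (simp add: norm_mult norm_power)
  qed
  moreover have "\<dots> \<le> 72"
  proof (rule coefficient_majorant_le)
    have "(\<Sum>n<5. (cmod (c n))\<^sup>2) \<le> 1"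
      unfolding c_def using w(1,2) by (rule sum_taylor_coeff_squares_le)
    then show "(cmod (c 1))\<^sup>2 + (cmod (c 2))\<^sup>2 + (cmod (c 3))\<^sup>2 + (cmod (c 4))\<^sup>2 \<le> 1"
      using sum_mono2[of "{..<5}" "{1, 2, 3, 4}" "\<lambda>n. (cmod (c n))\<^sup>2"] by simp
  qed simp_all
  \<comment> \<open>The constant is \<open>72 / 192 = 3 / 8\<close>.\<close>
  ultimately show ?thesis
    by (simp only: norm_divide norm_minus_cancel) simp
qed

subsection \<open>The extremal function\<close>

text \<open>The Noshiro-Warschawski criterion. If \<open>f a = f b\<close> with \<open>a\<close> and
  \<open>b\<close> distinct, then along the segment from \<open>a\<close> to \<open>b\<close> the
  real part of \<open>f / (b - a)\<close> has derivative \<open>Re f' > 0\<close>, so it increases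
  strictly although its end values agree.\<close>

lemma inj_on_Re_deriv_pos:
  assumes S: "convex S" and f: "\<And>z. z \<in> S \<Longrightarrow> (f has_field_derivative f' z) (at z)"
    and pos: "\<And>z. z \<in> S \<Longrightarrow> 0 < Re (f' z)"
  shows "inj_on f S"
proof (rule inj_onI, rule ccontr)
  fix a b assume ab: "a \<in> S" "b \<in> S" "f a = f b" "a \<noteq> b"
  define \<gamma> where "\<gamma> = (\<lambda>t::real. a + of_real t * (b - a))"
  have \<gamma>: "\<gamma> t \<in> S" if "0 \<le> t" "t \<le> 1" for t
    using convexD_alt[OF S ab(1,2) that] by (simp add: \<gamma>_def algebra_simps scaleR_conv_of_real)
  have "Re (f (\<gamma> 0) / (b - a)) < Re (f (\<gamma> 1) / (b - a))"
  proof (rule DERIV_pos_imp_increasing[where f = "\<lambda>t. Re (f (\<gamma> t) / (b - a))"])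
    fix t :: real assume t: "0 \<le> t" "t \<le> 1"
    have "(\<gamma> has_vector_derivative (b - a)) (at t)"
      unfolding \<gamma>_def by (auto intro!: derivative_eq_intros)
    from field_vector_diff_chain_at[OF this f[OF \<gamma>[OF t]]]
    have "((\<lambda>t. f (\<gamma> t)) has_vector_derivative (b - a) * f' (\<gamma> t)) (at t)"
      by (simp add: o_def)
    from has_vector_derivative_mult_left[OF this, of "inverse (b - a)"]
    have "((\<lambda>t. f (\<gamma> t) / (b - a)) has_vector_derivative f' (\<gamma> t)) (at t)"
      using ab by (simp flip: divide_inverse)
    then have "((\<lambda>t. Re (f (\<gamma> t) / (b - a))) has_field_derivative Re (f' (\<gamma> t))) (at t)"
      by (rule has_field_derivative_Re)
    then show "\<exists>y. ((\<lambda>t. Re (f (\<gamma> t) / (b - a))) has_real_derivative y) (at t) \<and> 0 < y"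
      using pos \<gamma>[OF t] by blast
  qed simp
  then show False
    using ab by (simp add: \<gamma>_def)
qed

text \<open>
  The expansion of \<open>\<integral>\<^sub>0\<^sup>u (e\<^sup>s - 1) / s ds\<close>; the constant coefficient is \<open>0\<close> because division by zero
  yields \<open>0\<close>.
\<close>
definition ein_fps :: "complex fps" where
  "ein_fps = Abs_fps (\<lambda>n. 1 / (of_nat n * fact n))"

text \<open>In terms of the classical entire exponential integral Ein, this is
  \<open>- Ein (- u)\<close>.\<close>

definition ein :: "complex \<Rightarrow> complex" where
  "ein = eval_fps ein_fps"

lemma fps_conv_radius_ein_fps: "fps_conv_radius ein_fps = \<infinity>"
  unfolding fps_conv_radius_def
proof (rule conv_radius_inftyI'')
  fix z :: complex
  show "summable (\<lambda>n. fps_nth ein_fps n * z ^ n)"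
  proof (rule summable_comparison_test')
    show "summable (\<lambda>n. inverse (fact n) * norm z ^ n)"
      by (rule summable_exp)
    show "norm (fps_nth ein_fps n * z ^ n) \<le> inverse (fact n) * norm z ^ n" if "1 \<le> n" for n
    proof -
      have "1 / (real n * fact n) \<le> 1 / fact n"
        using that by (intro divide_left_mono) auto
      from mult_right_mono[OF this, of "norm z ^ n"] show ?thesis
        by (simp add: ein_fps_def norm_mult norm_divide norm_power inverse_eq_divide)
    qed
  qed
qed

text \<open>The product form of the derivative covers \<open>u = 0\<close> without a case
  distinction.\<close>

lemma has_field_derivative_ein:
  obtains e where "(ein has_field_derivative e) (at u)" and "u * e = exp u - 1"
proof
  show "(ein has_field_derivative eval_fps (fps_deriv ein_fps) u) (at u)"
    unfolding ein_def by (rule has_field_derivative_eval_fps) (simp add: fps_conv_radius_ein_fps)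
  have radius: "fps_conv_radius (fps_deriv ein_fps) = \<infinity>"
    using fps_conv_radius_deriv[of ein_fps] by (simp add: fps_conv_radius_ein_fps)
  \<comment> \<open>Multiplying the n-th coefficient by \<open>n\<close> leaves
    \<open>1 / fact n\<close>, except at \<open>n = 0\<close>, where it leaves 0; hence the
    subtracted 1.\<close>
  have "fps_X * fps_deriv ein_fps = fps_exp 1 - 1"
    by (simp add: fps_eq_iff fps_mult_fps_X_deriv_shift ein_fps_def)
  then have "eval_fps (fps_X * fps_deriv ein_fps) u = eval_fps (fps_exp 1 - 1) u"
    by simp
  then show "u * eval_fps (fps_deriv ein_fps) u = exp u - 1"
    by (simp add: eval_fps_mult eval_fps_diff radius)
qed

lemma ein_0: "ein 0 = 0"
  by (simp add: ein_def eval_fps_at_0 ein_fps_def)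

text \<open>The tail from the fourth power on is dominated by a geometric series of ratio
  \<open>1 / 5\<close>, because \<open>fact (n + 4)\<close> is at least \<open>24 * 5 ^ n\<close>.
  The sum is \<open>(1 / 96) * (5 / 4)\<close>.\<close>

lemma ein_approx:
  assumes "norm u \<le> 1"
  shows "norm (ein u - (u + u\<^sup>2 / 4 + u ^ 3 / 18)) \<le> 5 / 384"
proof -
  define h where "h = (\<lambda>n. fps_nth ein_fps n * u ^ n)"
  have h: "h sums ein u"
    unfolding h_def ein_def by (rule sums_eval_fps) (simp add: fps_conv_radius_ein_fps)
  then have "ein u = (\<Sum>n. h (n + 4)) + (\<Sum>n<4. h n)"
    using suminf_split_initial_segment sums_iff by metis
  also have "(\<Sum>n<4. h n) = u + u\<^sup>2 / 4 + u ^ 3 / 18"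
    by (simp add: h_def ein_fps_def eval_nat_numeral)
  finally have "ein u - (u + u\<^sup>2 / 4 + u ^ 3 / 18) = (\<Sum>n. h (n + 4))"
    by simp
  also have "norm \<dots> \<le> (\<Sum>n. 1 / 96 * (1 / 5) ^ n)"
  proof (rule norm_suminf_le)
    fix n
    have "24 * 5 ^ n \<le> (fact (n + 4) :: real)"
    proof (induction n)
      case (Suc n)
      have "5 * (24 * 5 ^ n) \<le> real (n + 5) * fact (n + 4)"
        using Suc by (intro mult_mono) auto
      also have "real (n + 5) * fact (n + 4) = fact (Suc n + 4)"
        by (simp add: eval_nat_numeral)
      finally show ?case by simp
    qed (simp add: eval_nat_numeral)
    then have "4 * (24 * 5 ^ n) \<le> real (n + 4) * fact (n + 4)"
      by (intro mult_mono) auto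
    then have "1 / (real (n + 4) * fact (n + 4)) \<le> 1 / (4 * (24 * 5 ^ n))"
      by (intro divide_left_mono) auto
    moreover have "norm (u ^ (n + 4)) \<le> 1"
      using assms by (simp add: norm_power power_le_one del: power_Suc)
    ultimately have "1 / (real (n + 4) * fact (n + 4)) * norm (u ^ (n + 4)) \<le> 1 / (4 * (24 * 5 ^ n)) * 1"
      by (intro mult_mono) auto
    moreover have "norm (h (n + 4)) = 1 / (real (n + 4) * fact (n + 4)) * norm (u ^ (n + 4))"
      unfolding h_def ein_fps_def fps_nth_Abs_fps norm_mult norm_divide norm_one norm_of_nat norm_fact ..
    ultimately show "norm (h (n + 4)) \<le> 1 / 96 * (1 / 5) ^ n"
      by (simp add: power_divide)
  qed (auto intro: summable_mult)
  also have "\<dots> = 5 / 384"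
    by (subst suminf_mult) (simp_all add: suminf_geometric)
  finally show ?thesis .
qed

text \<open>
  Up to small terms the imaginary part is \<open>3 y / 2 + x y / 4\<close> for \<open>u = x + i y\<close>; taking
  moduli at once would only give \<open>3 / 2 + 1 / 8 + \<dots>\<close>, which exceeds \<open>\<pi> / 2\<close>.
\<close>
lemma abs_Im_ein_less:
  assumes "norm u < 1"
  shows "\<bar>Im (ein u / 2 + u)\<bar> < pi / 2"
proof -
  define x y where "x = \<bar>Re u\<bar>" and "y = \<bar>Im u\<bar>"
  define d where "d = ein u - (u + u\<^sup>2 / 4 + u ^ 3 / 18)"
  have xy: "x\<^sup>2 + y\<^sup>2 \<le> 1"
    using assms by (simp add: x_def y_def abs_square_le_1 flip: cmod_power2)
  have "\<bar>Im d\<bar> \<le> 5 / 384"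
    using ein_approx[of u] assms abs_Im_le_cmod[of d] by (simp add: d_def)
  moreover have "\<bar>Im (u ^ 3)\<bar> \<le> 1"
    using abs_Im_le_cmod[of "u ^ 3"] power_le_one[of "norm u" 3] assms by (simp add: norm_power)
  moreover have "\<bar>Re u * Im u\<bar> = x * y"
    by (simp add: x_def y_def abs_mult)
  moreover have "Im (ein u / 2 + u) = 3 / 2 * Im u + Re u * Im u / 4 + Im (u ^ 3) / 36 + Im d / 2"
    by (simp add: d_def Im_power2 field_simps)
  ultimately have "\<bar>Im (ein u / 2 + u)\<bar> \<le> 3 / 2 * y + x * y / 4 + 1 / 36 + 5 / 768"
    unfolding y_def by linarith
  moreover have "3 / 2 * y + x * y / 4 \<le> 73 / 48"
  proof -
    \<comment> \<open>The factor 6 gives \<open>x\<^sup>2\<close> the same coefficient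
      \<open>3 / 4\<close> as the first square gives \<open>y\<^sup>2\<close>, so that
      \<open>xy\<close> applies to their sum.\<close>
    have "0 \<le> 3 / 4 * (1 - y)\<^sup>2 + (6 * x - y)\<^sup>2 / 48"
      by simp
    also have "\<dots> = 3 / 4 + 3 / 4 * (x\<^sup>2 + y\<^sup>2) + y\<^sup>2 / 48 - (3 / 2 * y + x * y / 4)"
      by (simp add: power2_eq_square field_simps)
    finally have "3 / 2 * y + x * y / 4 \<le> 3 / 4 + 3 / 4 * (x\<^sup>2 + y\<^sup>2) + y\<^sup>2 / 48"
      by simp
    also have "\<dots> \<le> 3 / 4 + 3 / 4 * 1 + 1 / 48"
      using xy zero_le_power2[of x] by (intro add_mono mult_left_mono divide_right_mono) linarith+
    finally show ?thesis by simp
  qed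
  \<comment> \<open>The bounds above add up to less than 1.556, while this gives
    \<open>pi / 2 > 1.56\<close>.\<close>
  moreover have "312 / 100 < pi"
    using pi_approx(1) by simp
  ultimately show ?thesis
    by linarith
qed

text \<open>For an odd function the defining equation reads
  \<open>z * f' / f = exp (z\<^sup>2)\<close>. Integrating
  \<open>f' / f - 1 / z = (exp (z\<^sup>2) - 1) / z\<close> gives \<open>ein (z\<^sup>2) / 2\<close>
  as the logarithm of \<open>f / z\<close>.\<close>

definition extremal_f1 :: "complex \<Rightarrow> complex" where
  "extremal_f1 z = z * exp (ein (z\<^sup>2) / 2)"

lemma has_field_derivative_extremal_f1:
  "(extremal_f1 has_field_derivative exp (ein (z\<^sup>2) / 2 + z\<^sup>2)) (at z)"
proof -
  obtain e where e: "(ein has_field_derivative e) (at (z\<^sup>2))" "z\<^sup>2 * e = exp (z\<^sup>2) - 1"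
    by (rule has_field_derivative_ein)
  have "((\<lambda>z. ein (z\<^sup>2)) has_field_derivative e * (2 * z)) (at z)"
    by (rule DERIV_chain2[where g = "\<lambda>z. z\<^sup>2", OF e(1)]) (auto intro!: derivative_eq_intros)
  then have "((\<lambda>z. z * exp (ein (z\<^sup>2) / 2)) has_field_derivative
      exp (ein (z\<^sup>2) / 2) * (1 + z\<^sup>2 * e)) (at z)"
    by (auto intro!: derivative_eq_intros simp: algebra_simps power2_eq_square)
  then show ?thesis
    by (simp add: e(2) exp_add extremal_f1_def[abs_def])
qed

lemma extremal_f1_holomorphic: "extremal_f1 holomorphic_on A"
  unfolding holomorphic_on_def field_differentiable_def
  using has_field_derivative_extremal_f1 has_field_derivative_at_within by blast

text \<open>The function is odd, so the denominator is \<open>2 * extremal_f1 z\<close>; at 0 both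
  sides are 1.\<close>

lemma sym_quotient_extremal_f1: "sym_quotient extremal_f1 z = exp (z\<^sup>2)"
  by (auto simp: sym_quotient_def DERIV_imp_deriv[OF has_field_derivative_extremal_f1] exp_add)
    (auto simp: extremal_f1_def)

lemma is_extremal_f1_extremal_f1: "is_extremal_f1 extremal_f1"
  by (auto simp: is_extremal_f1_def extremal_f1_holomorphic sym_quotient_extremal_f1
    DERIV_imp_deriv[OF has_field_derivative_extremal_f1] ein_0 extremal_f1_def)

lemma extremal_f1_in_class_S_Se: "extremal_f1 \<in> class_S_Se"
proof -
  have "inj_on extremal_f1 unit_disc"
  proof (rule inj_on_Re_deriv_pos[OF _ has_field_derivative_extremal_f1])
    fix z :: complex assume "z \<in> unit_disc"
    then have "\<bar>Im (ein (z\<^sup>2) / 2 + z\<^sup>2)\<bar> < pi / 2"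
      by (intro abs_Im_ein_less) (simp add: norm_power abs_square_less_1)
    then have "0 < cos (Im (ein (z\<^sup>2) / 2 + z\<^sup>2))"
      by (intro cos_gt_zero_pi) linarith+
    then show "0 < Re (exp (ein (z\<^sup>2) / 2 + z\<^sup>2))"
      by (simp add: Re_exp)
  qed simp
  moreover have "sym_quotient extremal_f1 \<prec>\<^sub>s exp"
    unfolding subordinate_def sym_quotient_extremal_f1
    by (intro exI[of _ "\<lambda>z. z\<^sup>2"]) (auto intro!: holomorphic_intros simp: norm_power abs_square_less_1)
  ultimately show ?thesis
    using is_extremal_f1_extremal_f1 by (auto simp: class_S_Se_def class_S_def is_extremal_f1_def)
qed

theorem corollary2p9:
  shows "(\<forall>f\<in>class_S_Se. norm (hankel23 (disc_inverse f) - hankel23 f) \<le> 3 / 8) \<and>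
         (\<exists>f1. is_extremal_f1 f1 \<and>
               (\<forall>g. is_extremal_f1 g \<longrightarrow> (\<forall>z\<in>unit_disc. g z = f1 z)) \<and>
               f1 \<in> class_S_Se \<and>
               taylor_coeff f1 2 = 0 \<and> taylor_coeff f1 3 = 1 / 2 \<and>
               taylor_coeff f1 4 = 0 \<and> taylor_coeff f1 5 = 1 / 4 \<and>
               norm (hankel23 (disc_inverse f1) - hankel23 f1) = 3 / 8)"
proof (intro conjI exI[of _ extremal_f1] ballI allI impI)
  note extremal = is_extremal_f1_extremal_f1[unfolded is_extremal_f1_def]
  have w: "(\<lambda>z::complex. z\<^sup>2) holomorphic_on unit_disc" "(0::complex)\<^sup>2 = 0"
    by (auto intro!: holomorphic_intros)
  have "(\<lambda>z::complex. z\<^sup>2) has_fps_expansion fps_X\<^sup>2"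
    by (rule has_fps_expansion_fps_X_power)
  \<comment> \<open>The Schwarz function is the square, so \<open>c\<^sub>2 = 1\<close> and all
    other coefficients vanish, the equality case of the coefficient estimate.\<close>
  then have c: "taylor_coeff (\<lambda>z. z\<^sup>2) n = (if n = 2 then 1 else 0)" for n
    by (simp add: fps_expansion_eqI)
  have "taylor_coeff extremal_f1 2 = 0 \<and> taylor_coeff extremal_f1 3 = 1 / 2 \<and>
      taylor_coeff extremal_f1 4 = 0 \<and> taylor_coeff extremal_f1 5 = 1 / 4"
    using sym_quotient_coeffs[of extremal_f1, OF _ _ _ w] extremal by (simp add: c)
  then show a: "taylor_coeff extremal_f1 2 = 0" "taylor_coeff extremal_f1 3 = 1 / 2"
    "taylor_coeff extremal_f1 4 = 0" "taylor_coeff extremal_f1 5 = 1 / 4"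
    by auto
  show "extremal_f1 \<in> class_S_Se"
    by (rule extremal_f1_in_class_S_Se)
  \<comment> \<open>As \<open>a 2 = 0\<close>, only \<open>- 3 * (a 3) ^ 3 = - 3 / 8\<close>
    survives.\<close>
  then show "norm (hankel23 (disc_inverse extremal_f1) - hankel23 extremal_f1) = 3 / 8"
    by (subst hankel23_inverse_diff) (simp_all add: class_S_Se_def a power_divide norm_divide)
  show "g z = extremal_f1 z" if "is_extremal_f1 g" "z \<in> unit_disc" for g z
    by (rule sym_quotient_unique[OF _ _ _ _ _ _ w]) (use that extremal in \<open>auto simp: is_extremal_f1_def\<close>)
qed (fact hankel23_inverse_diff_bound is_extremal_f1_extremal_f1)+

end
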